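(* Let $h=h_{\mathcal{R}}(\delta)=1-(2\delta-\delta^2)\mu_1$, and let $0<\delta<2$ and $0\le\gamma<1$ satisfy $$0\le\gamma<\frac{1-\sqrt{h}}{1-\sqrt{h}+\delta\sqrt{\mu_2}} .$$ Let $\{x_k\}$ be the sequence of random iterates generated, from $x_0=x_1\in\mathbb{R}^n$, by the momentum method $x_{k+1}=x_k-\delta\,\nabla^Bf_i(x_k)+\gamma(x_k-x_{k-1})$, where at iteration $k$ the index $i=i_k$ is drawn according to $\mathcal{R}$ at $x_k$. Put $\Pi_1=\sqrt{h}$, $\Pi_2=\Pi_4=\gamma$, $\Pi_3=\delta\sqrt{\mu_2}$, $D=\sqrt{(\Pi_1-\Pi_4)^2+4\Pi_2\Pi_3}$ and $$\Gamma_1=\frac{\Pi_1-\Pi_4+D}{2\Pi_3},\quad \Gamma_2=\frac{\Pi_1-\Pi_4-D}{2\Pi_3},\quad \Gamma_3=\frac{\Pi_3}{D},\quad \rho_1=\frac{\Pi_1+\Pi_4-D}{2},\quad \rho_2=\frac{\Pi_1+\Pi_4+D}{2}.$$ Then the sequence of iterates $\{x_k\}$ converges and, for all $k\ge 1$, the following inequalities hold componentwise: $$\mathbb{E}\begin{bmatrix} d_B(x_{k+1},\mathcal{X})\\ \|x_{k+1}-x_k\|_B\end{bmatrix}\le\begin{bmatrix}-\Gamma_2\Gamma_3\,\rho_1^k+\Gamma_1\Gamma_3\,\rho_2^k\\ -\Gamma_3\,\rho_1^k+\Gamma_3\,\rho_2^k\end{bmatrix}d_B(x_0,\mathcal{X})\le\begin{bmatrix}1\\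 2\Gamma_3\end{bmatrix}\rho_2^k\,d_B(x_0,\mathcal{X}),$$ where $\Gamma_3\ge 0$ and $0\le|\rho_1|\le\rho_2<1$.
   Context: $A\in\mathbb{R}^{m\times n}$ has no zero rows, $b\in\mathbb{R}^m$, the system $Ax\le b$ is consistent, and $\mathcal{X}=\{x\in\mathbb{R}^n: Ax\le b\}$. $B\in\mathbb{R}^{n\times n}$ is symmetric positive definite, $\|x\|_B^2=x^TBx$, $\|v\|_{B^{-1}}^2=v^TB^{-1}v$, and $d_B(x,\mathcal{X})=\inf_{y\in\mathcal{X}}\|x-y\|_B$. For a real $t$, $t^+=\max\{t,0\}$. $S_1,\dots,S_q\in\mathbb{R}^m_+$ are fixed sketching vectors (with $A^TS_i\ne 0$), and $$f_i(x)=\frac{|[S_i^T(Ax-b)]^+|^2}{2\|A^TS_i\|_{B^{-1}}^2},\qquad \nabla^B f_i(x)=\frac{[S_i^T(Ax-b)]^+}{\|A^TS_i\|_{B^{-1}}^2}B^{-1}A^TS_i .$$ A sampling rule $\mathcal{R}$ prescribes, given a current point $x$, how a random index $i\in\{1,\dots,q\}$ is chosen; $\mathbb{E}[\,\cdot\mid i\sim\mathcal{R}]$ is the resulting expectation, and $f(x)=\mathbb{E}[f_i(x)\mid i\sim\mathcal{R}]$. The spectral constants $\mu_1>0$ and $\mu_2\le 1$ of the rule are constants such that $\frac{\mu_1}{2}d_B(x,\mathcal{X})^2\le f(x)\le\frac{\mu_2}{2}d_B(x,\mathcal{X})^2$ for all $x\in\mathbb{R}^n$.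
   Formalization: The displayed inequalities are stated only when D ≠ 0; D = 0 occurs only for γ = 0, δ = 1, μ₁ = μ₂ = 1, where Γ₃ = Π₃/D is undefined. Convergence (almost sure) and the bounds on ρ₁, ρ₂ are proved without this condition. *)

theory Defs
  imports "HOL-Probability.Probability"
begin

definition sym_pos_def :: "real ^ 'n ^ 'n \<Rightarrow> bool" where
  "sym_pos_def B \<longleftrightarrow> transpose B = B \<and> (\<forall>v. v \<noteq> 0 \<longrightarrow> v \<bullet> (B *v v) > 0)"

definition B_norm :: "real ^ 'n ^ 'n \<Rightarrow> real ^ 'n \<Rightarrow> real" where
  "B_norm B x = sqrt (x \<bullet> (B *v x))"

definition B_dist :: "real ^ 'n ^ 'n \<Rightarrow> real ^ 'n \<Rightarrow> (real ^ 'n) set \<Rightarrow> real" where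
  "B_dist B x X = (INF y\<in>X. B_norm B (x - y))"

text \<open>The order on vectors is the componentwise one.\<close>

definition feasible :: "real ^ 'n ^ 'm \<Rightarrow> real ^ 'm \<Rightarrow> (real ^ 'n) set" where
  "feasible A b = {x. A *v x \<le> b}"

definition sketch_loss ::
  "real ^ 'n ^ 'm \<Rightarrow> real ^ 'm \<Rightarrow> real ^ 'n ^ 'n \<Rightarrow> real ^ 'm \<Rightarrow> real ^ 'n \<Rightarrow> real" where
  "sketch_loss A b B s x =
     (max (s \<bullet> (A *v x - b)) 0)\<^sup>2 / (2 * (B_norm (matrix_inv B) (transpose A *v s))\<^sup>2)"

text \<open>The gradient of \<^const>\<open>sketch_loss\<close> with respect to the inner product induced by \<open>B\<close>.\<close>

definition sketch_grad ::
  "real ^ 'n ^ 'm \<Rightarrow> real ^ 'm \<Rightarrow> real ^ 'n ^ 'n \<Rightarrow> real ^ 'm \<Rightarrow> real ^ 'n \<Rightarrow> real ^ 'n" where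
  "sketch_grad A b B s x =
     (max (s \<bullet> (A *v x - b)) 0 / (B_norm (matrix_inv B) (transpose A *v s))\<^sup>2)
       *\<^sub>R (matrix_inv B *v (transpose A *v s))"

text \<open>A sampling rule assigns to each point the distribution of the index drawn there.\<close>

definition expected_loss ::
  "real ^ 'n ^ 'm \<Rightarrow> real ^ 'm \<Rightarrow> real ^ 'n ^ 'n \<Rightarrow> ('q \<Rightarrow> real ^ 'm) \<Rightarrow>
   (real ^ 'n \<Rightarrow> 'q pmf) \<Rightarrow> real ^ 'n \<Rightarrow> real" where
  "expected_loss A b B S R x = measure_pmf.expectation (R x) (\<lambda>i. sketch_loss A b B (S i) x)"

text \<open>The iterates as a function of the sequence \<open>s\<close> of selected indices: \<open>s k\<close> is the index
  used at iteration \<open>k \<ge> 1\<close>, so the \<open>k\<close>-th iterate depends on \<open>s 1, \<dots>, s (k - 1)\<close> only.\<close>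

fun momentum ::
  "real ^ 'n ^ 'm \<Rightarrow> real ^ 'm \<Rightarrow> real ^ 'n ^ 'n \<Rightarrow> ('q \<Rightarrow> real ^ 'm) \<Rightarrow> real \<Rightarrow> real \<Rightarrow>
   real ^ 'n \<Rightarrow> (nat \<Rightarrow> 'q) \<Rightarrow> nat \<Rightarrow> real ^ 'n" where
  "momentum A b B S \<delta> \<gamma> x0 s 0 = x0"
| "momentum A b B S \<delta> \<gamma> x0 s (Suc 0) = x0"
| "momentum A b B S \<delta> \<gamma> x0 s (Suc (Suc k)) =
     momentum A b B S \<delta> \<gamma> x0 s (Suc k)
     - \<delta> *\<^sub>R sketch_grad A b B (S (s (Suc k))) (momentum A b B S \<delta> \<gamma> x0 s (Suc k))
     + \<gamma> *\<^sub>R (momentum A b B S \<delta> \<gamma> x0 s (Suc k) - momentum A b B S \<delta> \<gamma> x0 s k)"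

text \<open>The random indices \<open>idx 1, idx 2, \<dots>\<close> are generated by the rule \<open>R\<close> along the iteration
  \<open>x\<close>: given the indices \<open>s 1, \<dots>, s (k - 1)\<close> drawn so far, the next one has law \<open>R (x s k)\<close>.
  Histories form a finite set when \<open>'q\<close> is finite, so conditioning on histories of positive
  probability is conditioning on the generated sigma-algebra.\<close>

definition drawn_by_rule ::
  "'w measure \<Rightarrow> (real ^ 'n \<Rightarrow> 'q pmf) \<Rightarrow> ((nat \<Rightarrow> 'q) \<Rightarrow> nat \<Rightarrow> real ^ 'n) \<Rightarrow>
   (nat \<Rightarrow> 'w \<Rightarrow> 'q) \<Rightarrow> bool" where
  "drawn_by_rule M R x idx \<longleftrightarrow>
     (\<forall>k\<ge>1. idx k \<in> measurable M (count_space UNIV)) \<and>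
     (\<forall>k\<ge>1. \<forall>s j. \<P>(\<omega> in M. \<forall>l\<in>{1..<k}. idx l \<omega> = s l) > 0 \<longrightarrow>
        \<P>(\<omega> in M. idx k \<omega> = j \<bar> \<forall>l\<in>{1..<k}. idx l \<omega> = s l) = pmf (R (x s k)) j)"

end

theory Submission
  imports Defs
begin

text \<open>
  For every feasible \<open>y\<close>, a sketched gradient step satisfies
  \<open>\<parallel>x - \<delta>\<nabla>f\<^sub>i(x) - y\<parallel>\<^sup>2 \<le> \<parallel>x - y\<parallel>\<^sup>2 - 2(2\<delta> - \<delta>\<^sup>2)f\<^sub>i(x)\<close>, because \<open>\<parallel>\<nabla>f\<^sub>i\<parallel>\<^sup>2 = 2f\<^sub>i\<close>
  and \<open>\<langle>\<nabla>f\<^sub>i(x), x - y\<rangle> \<ge> 2f\<^sub>i(x)\<close>. Taking the infimum over \<open>y\<close> and expectations, and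
  adding the momentum term by the triangle inequality, the expected distance \<open>P\<^sub>k\<close> and the expected
  step length \<open>Q\<^sub>k\<close> satisfy
  \<open>P\<^sub>k\<^sub>+\<^sub>1 \<le> \<Pi>\<^sub>1 P\<^sub>k + \<gamma> Q\<^sub>k\<close> and \<open>Q\<^sub>k\<^sub>+\<^sub>1 \<le> \<Pi>\<^sub>3 P\<^sub>k + \<gamma> Q\<^sub>k\<close>. The matrix of this recursion is
  nonnegative with eigenvalues \<open>\<rho>\<^sub>1, \<rho>\<^sub>2\<close>, and the bound on \<open>\<gamma>\<close> says \<open>\<gamma>\<Pi>\<^sub>3 < (1 - \<gamma>)(1 - \<Pi>\<^sub>1)\<close>,
  that is, \<open>\<rho>\<^sub>2 < 1\<close>. It also makes \<open>\<Sum>Q\<^sub>k\<close> finite, so almost surely the increments are summable.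
\<close>

text \<open>Nonnegativity of the variance is Jensen's inequality for the square. It turns bounds on
  second moments into bounds on first moments, to which the momentum term can be added by the
  triangle inequality.\<close>

lemma pmf_expectation_le_sqrt:
  fixes p :: "'q::finite pmf" and f :: "'q \<Rightarrow> real"
  shows "measure_pmf.expectation p f \<le> sqrt (measure_pmf.expectation p (\<lambda>i. (f i)\<^sup>2))"
proof -
  have "measure_pmf.variance p f
      = measure_pmf.expectation p (\<lambda>i. (f i)\<^sup>2) - (measure_pmf.expectation p f)\<^sup>2"
    by (intro measure_pmf.variance_eq integrable_measure_pmf_finite) auto
  moreover have "0 \<le> measure_pmf.variance p f"
    by (rule measure_pmf.variance_positive)
  ultimately show ?thesis
    by (intro real_le_rsqrt) simp
qed

section \<open>Geometry of the norm induced by \<open>B\<close>\<close>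

lemma symmetric_form_commute:
  fixes B :: "real ^ 'n ^ 'n"
  assumes "transpose B = B"
  shows "u \<bullet> (B *v v) = v \<bullet> (B *v u)"
  by (metis assms dot_lmul_matrix inner_commute vector_transpose_matrix)

locale spd_form =
  fixes B :: "real ^ 'n ^ 'n"
  assumes spd: "sym_pos_def B"
begin

lemma form_commute: "u \<bullet> (B *v v) = v \<bullet> (B *v u)"
  using spd by (intro symmetric_form_commute) (simp add: sym_pos_def_def)

lemma form_pos: "v \<noteq> 0 \<Longrightarrow> 0 < v \<bullet> (B *v v)"
  using spd by (simp add: sym_pos_def_def)

lemma form_nonneg: "0 \<le> v \<bullet> (B *v v)"
  using form_pos[of v] by (cases "v = 0") auto

lemma B_norm_nonneg: "0 \<le> B_norm B v"
  by (simp add: B_norm_def form_nonneg)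

lemma B_norm_sq: "(B_norm B v)\<^sup>2 = v \<bullet> (B *v v)"
  by (simp add: B_norm_def form_nonneg)

lemma B_norm_zero: "B_norm B 0 = 0"
  by (simp add: B_norm_def)

lemma B_norm_pos: "v \<noteq> 0 \<Longrightarrow> 0 < B_norm B v"
  by (simp add: B_norm_def form_pos)

lemma B_norm_scaleR: "B_norm B (c *\<^sub>R v) = \<bar>c\<bar> * B_norm B v"
  by (simp add: B_norm_def matrix_vector_mult_scaleR real_sqrt_mult flip: mult.assoc)

lemma B_norm_sq_add:
  "(B_norm B (u + v))\<^sup>2 = (B_norm B u)\<^sup>2 + 2 * (u \<bullet> (B *v v)) + (B_norm B v)\<^sup>2"
  using form_commute[of u v]
  by (simp add: B_norm_sq matrix_vector_right_distrib inner_add_left inner_add_right)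

lemma form_le_B_norm: "u \<bullet> (B *v v) \<le> B_norm B u * B_norm B v"
proof (cases "u = 0 \<or> v = 0")
  case False
  define a c where "a = B_norm B u" and "c = B_norm B v"
  have pos: "a > 0" "c > 0"
    using False B_norm_pos by (auto simp: a_def c_def)
  \<comment> \<open>Cauchy-Schwarz: scaling each vector by the norm of the other makes both square
    terms equal, so the expansion factors as \<open>2 * (a * c)\<close> times the desired
    difference.\<close>
  have "0 \<le> (B_norm B (c *\<^sub>R u + (- a) *\<^sub>R v))\<^sup>2"
    by simp
  also have "\<dots> = (c * a)\<^sup>2 - 2 * (a * c) * (u \<bullet> (B *v v)) + (a * c)\<^sup>2"
    by (simp only: B_norm_sq_add B_norm_scaleR matrix_vector_mult_scaleR)
       (simp add: a_def c_def power_mult_distrib)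
  also have "\<dots> = 2 * (a * c) * (a * c - u \<bullet> (B *v v))"
    by (simp add: power2_eq_square algebra_simps)
  finally show ?thesis
    using mult_pos_pos[OF pos] by (auto simp: zero_le_mult_iff a_def c_def)
qed (auto simp: B_norm_zero)

lemma B_norm_triangle: "B_norm B (u + v) \<le> B_norm B u + B_norm B v"
proof (rule power2_le_imp_le)
  show "(B_norm B (u + v))\<^sup>2 \<le> (B_norm B u + B_norm B v)\<^sup>2"
    unfolding B_norm_sq_add using form_le_B_norm[of u v] by (simp add: power2_sum)
qed (simp add: B_norm_nonneg)

text \<open>By compactness \<open>B_norm B\<close> attains its minimum on the Euclidean unit sphere,
  and it is positive there by definiteness; the reciprocal of the minimum serves as
  \<open>C\<close>.\<close>

lemma norm_le_B_norm: "\<exists>C>0. \<forall>v. norm v \<le> C * B_norm B v"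
proof -
  have cont: "continuous_on (sphere 0 1) (B_norm B)"
    unfolding B_norm_def by (intro continuous_intros)
  have "\<exists>e\<in>sphere (0 :: real ^ 'n) 1. \<forall>v\<in>sphere 0 1. B_norm B e \<le> B_norm B v"
    by (intro continuous_attains_inf cont) auto
  then obtain e where e: "norm e = 1" and min: "\<And>v. norm v = 1 \<Longrightarrow> B_norm B e \<le> B_norm B v"
    by auto
  have pos: "0 < B_norm B e"
    using e by (intro B_norm_pos) auto
  have "norm v \<le> 1 / B_norm B e * B_norm B v" for v
  proof (cases "v = 0")
    case False
    then have "B_norm B e \<le> B_norm B ((1 / norm v) *\<^sub>R v)"
      by (intro min) simp
    with False pos show ?thesis
      by (simp add: B_norm_scaleR field_simps)
  qed (simp add: B_norm_zero)
  with pos show ?thesis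
    by (intro exI[of _ "1 / B_norm B e"]) auto
qed

text \<open>\<open>matrix_inv\<close> is a choice, so existence has to be shown first: definiteness
  makes the kernel of \<open>B\<close> trivial, hence \<open>B\<close> is invertible and the chosen
  matrix is a genuine inverse.\<close>

lemma mult_matrix_inv: "B *v (matrix_inv B *v w) = w"
proof -
  have "\<forall>v. B *v v = 0 \<longrightarrow> v = 0"
    using form_pos by (metis inner_zero_right less_irrefl)
  then have "invertible B"
    using invertible_left_inverse matrix_left_invertible_ker by blast
  then have "B ** matrix_inv B = mat 1"
    unfolding matrix_inv_def invertible_def by (rule someI2_ex) auto
  then show ?thesis
    by (simp add: matrix_vector_mul_assoc)
qed

text \<open>Substituting \<open>w = B *v (matrix_inv B *v w)\<close> turns the dual norm into the
  \<open>B\<close>-norm of the step direction, so its positivity is inherited from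
  \<open>B\<close>.\<close>

lemma B_norm_matrix_inv: "B_norm (matrix_inv B) w = B_norm B (matrix_inv B *v w)"
  by (simp add: B_norm_def mult_matrix_inv inner_commute)

lemma B_norm_matrix_inv_pos: "w \<noteq> 0 \<Longrightarrow> 0 < B_norm (matrix_inv B) w"
  unfolding B_norm_matrix_inv
  by (rule B_norm_pos) (metis mult_matrix_inv matrix_vector_mult_0_right)

section \<open>Distance to a set in the \<open>B\<close>-norm\<close>

lemma bdd_below_B_norm: "bdd_below ((\<lambda>y. B_norm B (x - y)) ` X)"
  by (rule bdd_belowI2[of _ 0]) (rule B_norm_nonneg)

lemma B_dist_le: "y \<in> X \<Longrightarrow> B_dist B x X \<le> B_norm B (x - y)"
  unfolding B_dist_def by (intro cINF_lower bdd_below_B_norm)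

lemma B_dist_greatest:
  "X \<noteq> {} \<Longrightarrow> (\<And>y. y \<in> X \<Longrightarrow> c \<le> B_norm B (x - y)) \<Longrightarrow> c \<le> B_dist B x X"
  unfolding B_dist_def by (rule cINF_greatest)

lemma B_dist_nonneg: "X \<noteq> {} \<Longrightarrow> 0 \<le> B_dist B x X"
  by (rule B_dist_greatest) (auto intro: B_norm_nonneg)

text \<open>The triangle inequality is applied to each competitor \<open>y\<close> and the infimum
  is taken last, so no nearest point enters. This is how the momentum term is split off.\<close>

lemma B_dist_add_le:
  assumes ne: "X \<noteq> {}"
  shows "B_dist B (x + v) X \<le> B_dist B x X + B_norm B v"
proof -
  have "B_dist B (x + v) X - B_norm B v \<le> B_norm B (x - y)" if "y \<in> X" for y
    using B_dist_le[OF that, of "x + v"] B_norm_triangle[of "x - y" v]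
    by (simp add: algebra_simps)
  then show ?thesis
    using B_dist_greatest[OF ne, of "B_dist B (x + v) X - B_norm B v" x] by simp
qed

section \<open>One sketched gradient step\<close>

lemma B_norm_sketch_grad_sq:
  assumes "transpose A *v s \<noteq> 0"
  shows "(B_norm B (sketch_grad A b B s x))\<^sup>2 = 2 * sketch_loss A b B s x"
  using B_norm_matrix_inv_pos[OF assms]
  by (simp add: sketch_grad_def sketch_loss_def B_norm_scaleR power_mult_distrib
      power_divide B_norm_matrix_inv field_simps power2_eq_square)

text \<open>Nonnegative weights combine the constraints into one inequality valid on the feasible
  set, so \<open>s \<bullet> (A *v y - b) \<le> 0\<close>. In the inner product, \<open>B\<close>
  cancels the \<open>matrix_inv B\<close> of the gradient.\<close>

lemma inner_sketch_grad_ge: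
  assumes "transpose A *v s \<noteq> 0" and "0 \<le> s" and "y \<in> feasible A b"
  shows "2 * sketch_loss A b B s x \<le> (x - y) \<bullet> (B *v sketch_grad A b B s x)"
proof -
  define t where "t = s \<bullet> (A *v x - b)"
  define N where "N = (B_norm (matrix_inv B) (transpose A *v s))\<^sup>2"
  have N: "N > 0"
    using B_norm_matrix_inv_pos[OF assms(1)] by (simp add: N_def)
  have "0 \<le> s \<bullet> (b - A *v y)"
    unfolding inner_vec_def
    using assms(2,3) by (intro sum_nonneg) (auto simp: less_eq_vec_def feasible_def)
  then have "t \<le> s \<bullet> (A *v (x - y))"
    by (simp add: t_def matrix_vector_mult_diff_distrib inner_diff_right)
  also have "\<dots> = (x - y) \<bullet> (transpose A *v s)"
    by (simp add: dot_lmul_matrix inner_commute)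
  finally have "max t 0 * t / N \<le> max t 0 * ((x - y) \<bullet> (transpose A *v s)) / N"
    using N by (intro divide_right_mono mult_left_mono) auto
  \<comment> \<open>For negative \<open>t\<close> both sides vanish.\<close>
  moreover have "max t 0 * t = (max t 0)\<^sup>2"
    by (auto simp: max_def power2_eq_square)
  ultimately show ?thesis
    by (simp add: sketch_grad_def sketch_loss_def matrix_vector_mult_scaleR mult_matrix_inv
        flip: t_def N_def del: transpose_matrix_vector)
qed

lemma B_dist_sketch_step:
  assumes A: "transpose A *v s \<noteq> 0" "0 \<le> s" and ne: "feasible A b \<noteq> {}"
    and \<delta>: "0 < \<delta>" "\<delta> < 2"
  shows "(B_dist B (x - \<delta> *\<^sub>R sketch_grad A b B s x) (feasible A b))\<^sup>2
    \<le> (B_dist B x (feasible A b))\<^sup>2 - 2 * (2 * \<delta> - \<delta>\<^sup>2) * sketch_loss A b B s x"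
    (is "?d\<^sup>2 \<le> _ - ?c")
proof -
  let ?g = "sketch_grad A b B s x"
  have "2 * \<delta> - \<delta>\<^sup>2 = \<delta> * (2 - \<delta>)"
    by (simp add: power2_eq_square algebra_simps)
  then have c: "0 \<le> ?c"
    using \<delta> by (simp add: sketch_loss_def)
  \<comment> \<open>The infimum defining \<open>B_dist\<close> runs over unsquared norms, so the
    estimate is put under a root before passing to it.\<close>
  have "sqrt (?d\<^sup>2 + ?c) \<le> B_norm B (x - y)" if y: "y \<in> feasible A b" for y
  proof -
    have "x - \<delta> *\<^sub>R ?g - y = (x - y) + (- \<delta>) *\<^sub>R ?g"
      by (simp add: algebra_simps)
    then have "(B_norm B (x - \<delta> *\<^sub>R ?g - y))\<^sup>2
      = (B_norm B (x - y))\<^sup>2 + 2 * ((x - y) \<bullet> (B *v ((- \<delta>) *\<^sub>R ?g))) + (B_norm B ((- \<delta>) *\<^sub>R ?g))\<^sup>2"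
      by (simp only: B_norm_sq_add)
    also have "\<dots> = (B_norm B (x - y))\<^sup>2 - 2 * \<delta> * ((x - y) \<bullet> (B *v ?g)) + \<delta>\<^sup>2 * (B_norm B ?g)\<^sup>2"
      by (simp only: B_norm_scaleR matrix_vector_mult_scaleR) (simp add: power_mult_distrib)
    also have "\<dots> \<le> (B_norm B (x - y))\<^sup>2 - 2 * \<delta> * (2 * sketch_loss A b B s x) + \<delta>\<^sup>2 * (B_norm B ?g)\<^sup>2"
      using mult_left_mono[OF inner_sketch_grad_ge[OF A y, of x], of "2 * \<delta>"] \<delta> by simp
    also have "\<dots> = (B_norm B (x - y))\<^sup>2 - ?c"
      by (simp add: B_norm_sketch_grad_sq[OF A(1)] algebra_simps)
    finally have "(B_norm B (x - \<delta> *\<^sub>R ?g - y))\<^sup>2 \<le> (B_norm B (x - y))\<^sup>2 - ?c" .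
    moreover have "?d\<^sup>2 \<le> (B_norm B (x - \<delta> *\<^sub>R ?g - y))\<^sup>2"
      by (intro power_mono B_dist_le y B_dist_nonneg ne)
    ultimately have "?d\<^sup>2 + ?c \<le> (B_norm B (x - y))\<^sup>2"
      by linarith
    then show ?thesis
      by (rule real_le_lsqrt[rotated]) (rule B_norm_nonneg)
  qed
  then have "sqrt (?d\<^sup>2 + ?c) \<le> B_dist B x (feasible A b)"
    by (intro B_dist_greatest ne)
  then have "?d\<^sup>2 + ?c \<le> (B_dist B x (feasible A b))\<^sup>2"
    using c by (simp add: sqrt_le_D)
  then show ?thesis
    by linarith
qed

text \<open>Averaging the one-step bound and inserting the lower spectral bound contracts the
  squared distance by \<open>h\<close>; Jensen then gives the factor \<open>sqrt h\<close> for the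
  distance itself.\<close>

lemma expectation_B_dist_sketch_step:
  fixes p :: "'q::finite pmf"
  assumes A: "\<And>i. transpose A *v S i \<noteq> 0" "\<And>i. 0 \<le> S i" and ne: "feasible A b \<noteq> {}"
    and \<delta>: "0 < \<delta>" "\<delta> < 2"
    and lower: "\<mu> / 2 * (B_dist B x (feasible A b))\<^sup>2
      \<le> measure_pmf.expectation p (\<lambda>i. sketch_loss A b B (S i) x)"
  shows "measure_pmf.expectation p
      (\<lambda>i. B_dist B (x - \<delta> *\<^sub>R sketch_grad A b B (S i) x) (feasible A b))
    \<le> sqrt (1 - (2 * \<delta> - \<delta>\<^sup>2) * \<mu>) * B_dist B x (feasible A b)"
proof -
  let ?d = "\<lambda>i. B_dist B (x - \<delta> *\<^sub>R sketch_grad A b B (S i) x) (feasible A b)"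
  let ?D = "B_dist B x (feasible A b)"
  have int: "integrable (measure_pmf p) f" for f :: "'q \<Rightarrow> real"
    by (rule integrable_measure_pmf_finite) simp
  have c: "0 \<le> 2 * \<delta> - \<delta>\<^sup>2"
    using \<delta> by (simp add: power2_eq_square)
  have "measure_pmf.expectation p (\<lambda>i. (?d i)\<^sup>2)
      \<le> measure_pmf.expectation p
          (\<lambda>i. ?D\<^sup>2 - 2 * (2 * \<delta> - \<delta>\<^sup>2) * sketch_loss A b B (S i) x)"
    by (intro integral_mono int B_dist_sketch_step A ne \<delta>)
  also have "\<dots> = ?D\<^sup>2
      - 2 * (2 * \<delta> - \<delta>\<^sup>2) * measure_pmf.expectation p (\<lambda>i. sketch_loss A b B (S i) x)"
    by (subst Bochner_Integration.integral_diff) (simp_all add: int)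
  also have "\<dots> \<le> ?D\<^sup>2 - 2 * (2 * \<delta> - \<delta>\<^sup>2) * (\<mu> / 2 * ?D\<^sup>2)"
    using lower c by (intro diff_left_mono mult_left_mono) auto
  also have "\<dots> = (1 - (2 * \<delta> - \<delta>\<^sup>2) * \<mu>) * ?D\<^sup>2"
    by (simp add: field_simps)
  finally have "sqrt (measure_pmf.expectation p (\<lambda>i. (?d i)\<^sup>2))
      \<le> sqrt ((1 - (2 * \<delta> - \<delta>\<^sup>2) * \<mu>) * ?D\<^sup>2)"
    by (rule real_sqrt_le_mono)
  also have "\<dots> = sqrt (1 - (2 * \<delta> - \<delta>\<^sup>2) * \<mu>) * ?D"
    using B_dist_nonneg[OF ne] by (simp add: real_sqrt_mult)
  finally show ?thesis
    using pmf_expectation_le_sqrt[of p ?d] by linarith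
qed

text \<open>The squared gradient norm is twice the loss, so Jensen and the upper spectral bound give
  the factor \<open>sqrt \<mu>\<close>.\<close>

lemma expectation_B_norm_sketch_grad:
  fixes p :: "'q::finite pmf"
  assumes A: "\<And>i. transpose A *v S i \<noteq> 0" and ne: "feasible A b \<noteq> {}"
    and upper: "measure_pmf.expectation p (\<lambda>i. sketch_loss A b B (S i) x)
      \<le> \<mu> / 2 * (B_dist B x (feasible A b))\<^sup>2"
  shows "measure_pmf.expectation p (\<lambda>i. B_norm B (sketch_grad A b B (S i) x))
    \<le> sqrt \<mu> * B_dist B x (feasible A b)"
proof -
  have "measure_pmf.expectation p (\<lambda>i. B_norm B (sketch_grad A b B (S i) x))
      \<le> sqrt (measure_pmf.expectation p (\<lambda>i. (B_norm B (sketch_grad A b B (S i) x))\<^sup>2))"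
    by (rule pmf_expectation_le_sqrt)
  also have "\<dots> = sqrt (2 * measure_pmf.expectation p (\<lambda>i. sketch_loss A b B (S i) x))"
    by (simp add: B_norm_sketch_grad_sq A del: transpose_matrix_vector)
  also have "\<dots> \<le> sqrt (\<mu> * (B_dist B x (feasible A b))\<^sup>2)"
    using upper by (intro real_sqrt_le_mono) simp
  also have "\<dots> = sqrt \<mu> * B_dist B x (feasible A b)"
    using B_dist_nonneg[OF ne] by (simp add: real_sqrt_mult)
  finally show ?thesis .
qed

text \<open>A nonzero row of \<open>A\<close> yields a point at positive distance from the feasible set; this is what
  makes \<open>h\<close> nonnegative and \<open>\<mu>\<^sub>2\<close> positive.\<close>

lemma spectral_constants_le:
  assumes "row i A \<noteq> 0" and ne: "feasible A b \<noteq> {}"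
    and bounds: "\<And>y. \<mu>1 / 2 * (B_dist B y (feasible A b))\<^sup>2 \<le> g y"
      "\<And>y. g y \<le> \<mu>2 / 2 * (B_dist B y (feasible A b))\<^sup>2"
  shows "\<mu>1 \<le> \<mu>2"
proof -
  define r where "r = row i A"
  have r: "0 < r \<bullet> r"
    using assms(1) by (simp add: r_def)
  have comp: "(A *v y) $ i = r \<bullet> y" for y
    by (simp add: r_def row_def matrix_vector_mult_def inner_vec_def)
  obtain C where C: "C > 0" "\<And>v. norm v \<le> C * B_norm B v"
    using norm_le_B_norm by blast
  \<comment> \<open>The multiple of row \<open>i\<close> is chosen so that \<open>z\<close> violates
    constraint \<open>i\<close> by at least 1.\<close>
  define z where "z = ((\<bar>b $ i\<bar> + 1) / (r \<bullet> r)) *\<^sub>R r"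
  have rz: "r \<bullet> z = \<bar>b $ i\<bar> + 1"
    using r by (simp add: z_def)
  \<comment> \<open>The violation is bounded through Cauchy-Schwarz by the distance to
    \<open>y\<close>. The resulting lower bound is uniform in \<open>y\<close>, so it survives the
    infimum.\<close>
  have "1 / (norm r * C) \<le> B_norm B (z - y)" if "y \<in> feasible A b" for y
  proof -
    have "(A *v y) $ i \<le> b $ i"
      using that by (simp add: feasible_def less_eq_vec_def)
    then have "r \<bullet> y \<le> b $ i"
      by (simp only: comp)
    then have "1 \<le> r \<bullet> (z - y)"
      using rz by (simp add: inner_diff_right)
    also have "\<dots> \<le> norm r * norm (z - y)"
      by (rule norm_cauchy_schwarz)
    also have "\<dots> \<le> norm r * (C * B_norm B (z - y))"
      by (intro mult_left_mono C) simp
    finally show ?thesis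
      using r C by (simp add: field_simps)
  qed
  then have "1 / (norm r * C) \<le> B_dist B z (feasible A b)"
    by (rule B_dist_greatest[OF ne])
  moreover have "0 < 1 / (norm r * C)"
    using r C by simp
  ultimately have "0 < (B_dist B z (feasible A b))\<^sup>2"
    by (intro zero_less_power) linarith
  moreover have "\<mu>1 / 2 * (B_dist B z (feasible A b))\<^sup>2 \<le> \<mu>2 / 2 * (B_dist B z (feasible A b))\<^sup>2"
    using bounds[of z] by (rule order_trans)
  ultimately show ?thesis
    by simp
qed

end


section \<open>Expectations over finite histories of indices\<close>

text \<open>A function of a variable with finitely many values is a finite combination of indicators
  of its fibres.\<close>

lemma (in finite_measure) finite_range_integral:
  fixes f :: "'b \<Rightarrow> real"
  assumes T: "finite T" and Y: "Y \<in> measurable M (count_space T)"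
  shows "integrable M (\<lambda>\<omega>. f (Y \<omega>))"
    and "(\<integral>\<omega>. f (Y \<omega>) \<partial>M) = (\<Sum>t\<in>T. f t * measure M {\<omega>\<in>space M. Y \<omega> = t})"
proof -
  define E where "E t = {\<omega>\<in>space M. Y \<omega> = t}" for t
  have sets: "E t \<in> sets M" if "t \<in> T" for t
  proof -
    have "E t = Y -` {t} \<inter> space M"
      by (auto simp: E_def)
    with Y that T show ?thesis
      by (auto simp: measurable_count_space_eq2)
  qed
  have eq: "f (Y \<omega>) = (\<Sum>t\<in>T. f t * indicator (E t) \<omega>)" if "\<omega> \<in> space M" for \<omega>
  proof -
    have "Y \<omega> \<in> T"
      using measurable_space[OF Y that] by simp
    have "(\<Sum>t\<in>T. f t * indicator (E t) \<omega>) = (\<Sum>t\<in>T. if Y \<omega> = t then f t else 0)"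
      using that by (intro sum.cong) (auto simp: E_def)
    with \<open>Y \<omega> \<in> T\<close> T show ?thesis
      by simp
  qed
  have ind: "integrable M (indicat_real (E t))" if "t \<in> T" for t
    using sets[OF that] by (intro integrable_real_indicator) (auto simp: emeasure_eq_measure)
  then have int: "integrable M (\<lambda>\<omega>. f t * indicator (E t) \<omega>)" if "t \<in> T" for t
    using that by (intro integrable_mult_right) auto
  have "integrable M (\<lambda>\<omega>. \<Sum>t\<in>T. f t * indicator (E t) \<omega>)"
    by (intro Bochner_Integration.integrable_sum int)
  then show "integrable M (\<lambda>\<omega>. f (Y \<omega>))"
    by (subst Bochner_Integration.integrable_cong[OF refl eq])
  have "(\<integral>\<omega>. f (Y \<omega>) \<partial>M) = (\<integral>\<omega>. (\<Sum>t\<in>T. f t * indicator (E t) \<omega>) \<partial>M)"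
    by (intro Bochner_Integration.integral_cong eq refl)
  also have "\<dots> = (\<Sum>t\<in>T. f t * measure M (E t))"
    by (subst Bochner_Integration.integral_sum)
       (auto intro!: int sum.cong simp: ind sets Int_absorb2 sets.sets_into_space)
  finally show "(\<integral>\<omega>. f (Y \<omega>) \<partial>M) = (\<Sum>t\<in>T. f t * measure M {\<omega>\<in>space M. Y \<omega> = t})"
    by (simp add: E_def)
qed

text \<open>Restriction to \<open>I\<close> makes the value set finite and turns agreement on
  \<open>I\<close> into equality of functions, so each fibre is a finite intersection of
  events.\<close>

lemma measurable_history:
  fixes idx :: "nat \<Rightarrow> 'w \<Rightarrow> 'q::finite"
  assumes "finite I" and "\<And>l. l \<in> I \<Longrightarrow> idx l \<in> measurable M (count_space UNIV)"
  shows "(\<lambda>\<omega>. restrict (\<lambda>l. idx l \<omega>) I) \<in> measurable M (count_space (Pi\<^sub>E I (\<lambda>_. UNIV)))"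
proof (subst measurable_count_space_eq2)
  show "finite (Pi\<^sub>E I (\<lambda>_. UNIV :: 'q set))"
    using assms(1) by (intro finite_PiE) auto
  have "(\<lambda>\<omega>. restrict (\<lambda>l. idx l \<omega>) I) -` {s} \<inter> space M \<in> sets M"
    if "s \<in> Pi\<^sub>E I (\<lambda>_. UNIV)" for s :: "nat \<Rightarrow> 'q"
  proof -
    have "(\<lambda>\<omega>. restrict (\<lambda>l. idx l \<omega>) I) -` {s} \<inter> space M
        = {\<omega>\<in>space M. \<forall>l\<in>I. idx l \<omega> = s l}"
      using that by (auto simp: fun_eq_iff restrict_def PiE_def extensional_def)
    also have "\<dots> \<in> sets M"
    proof (intro sets.sets_Collect_finite_All assms(1))
      fix l assume "l \<in> I"
      then have "idx l -` {s l} \<inter> space M \<in> sets M"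
        by (intro measurable_sets[OF assms(2)]) auto
      moreover have "idx l -` {s l} \<inter> space M = {\<omega>\<in>space M. idx l \<omega> = s l}"
        by auto
      ultimately show "{\<omega>\<in>space M. idx l \<omega> = s l} \<in> sets M"
        by simp
    qed
    finally show ?thesis .
  qed
  then show "(\<lambda>\<omega>. restrict (\<lambda>l. idx l \<omega>) I) \<in> space M \<rightarrow> Pi\<^sub>E I (\<lambda>_. UNIV) \<and>
      (\<forall>s\<in>Pi\<^sub>E I (\<lambda>_. UNIV). (\<lambda>\<omega>. restrict (\<lambda>l. idx l \<omega>) I) -` {s} \<inter> space M \<in> sets M)"
    by auto
qed

context prob_space
begin

lemma integrable_history:
  fixes idx :: "nat \<Rightarrow> 'a \<Rightarrow> 'q::finite" and F :: "(nat \<Rightarrow> 'q) \<Rightarrow> real"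
  assumes "finite I" and "\<And>l. l \<in> I \<Longrightarrow> idx l \<in> measurable M (count_space UNIV)"
    and F: "\<And>s t. (\<And>l. l \<in> I \<Longrightarrow> s l = t l) \<Longrightarrow> F s = F t"
  shows "integrable M (\<lambda>\<omega>. F (\<lambda>l. idx l \<omega>))"
proof -
  have "F (\<lambda>l. idx l \<omega>) = F (restrict (\<lambda>l. idx l \<omega>) I)" for \<omega>
    by (rule F) simp
  moreover have "integrable M (\<lambda>\<omega>. F (restrict (\<lambda>l. idx l \<omega>) I))"
    using assms(1)
    by (intro finite_range_integral(1)[of "Pi\<^sub>E I (\<lambda>_. UNIV)"] measurable_history assms finite_PiE)
      auto
  ultimately show ?thesis
    by simp
qed

text \<open>The tower property for the history before time \<open>k\<close>. Both \<open>F\<close>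
  and the iterate depend on the index sequence only through that history, so both sides are finite
  sums over histories, the left one also over the next index.\<close>

lemma expectation_drawn_by_rule:
  fixes idx :: "nat \<Rightarrow> 'a \<Rightarrow> 'q::finite" and F :: "(nat \<Rightarrow> 'q) \<Rightarrow> 'q \<Rightarrow> real"
  assumes drawn: "drawn_by_rule M R x idx" and k: "1 \<le> k"
    and F: "\<And>s t j. (\<And>l. l \<in> {1..<k} \<Longrightarrow> s l = t l) \<Longrightarrow> F s j = F t j"
    and x: "\<And>s t. (\<And>l. l \<in> {1..<k} \<Longrightarrow> s l = t l) \<Longrightarrow> x s k = x t k"
  shows "expectation (\<lambda>\<omega>. F (\<lambda>l. idx l \<omega>) (idx k \<omega>))
    = expectation (\<lambda>\<omega>. measure_pmf.expectation (R (x (\<lambda>l. idx l \<omega>) k)) (F (\<lambda>l. idx l \<omega>)))"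
proof -
  define T where "T = Pi\<^sub>E {1..<k} (\<lambda>_. UNIV :: 'q set)"
  define H where "H \<omega> = restrict (\<lambda>l. idx l \<omega>) {1..<k}" for \<omega>
  have idx: "idx l \<in> measurable M (count_space UNIV)" if "1 \<le> l" for l
    using drawn that by (simp add: drawn_by_rule_def)
  have T: "finite T"
    unfolding T_def by (intro finite_PiE) auto
  have H: "H \<in> measurable M (count_space T)"
    unfolding H_def T_def by (intro measurable_history idx) auto
  have [measurable]: "Measurable.pred M (\<lambda>\<omega>. H \<omega> = s)" if "s \<in> T" for s
  proof -
    have "H -` {s} \<inter> space M \<in> sets M"
      using that by (intro measurable_sets[OF H]) auto
    moreover have "H -` {s} \<inter> space M = {\<omega>\<in>space M. H \<omega> = s}"
      by auto
    ultimately show ?thesis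
      by (simp add: pred_def)
  qed
  have hist: "(\<forall>l\<in>{1..<k}. idx l \<omega> = s l) \<longleftrightarrow> H \<omega> = s" if "s \<in> T" for s \<omega>
    using that by (auto simp: H_def T_def fun_eq_iff restrict_def PiE_def extensional_def)
  \<comment> \<open>The rule prescribes conditional laws only on histories of positive probability;
    on null histories both sides are zero.\<close>
  have law: "prob {\<omega>\<in>space M. H \<omega> = s \<and> idx k \<omega> = j}
      = prob {\<omega>\<in>space M. H \<omega> = s} * pmf (R (x s k)) j" if s: "s \<in> T" for s j
  proof (cases "prob {\<omega>\<in>space M. H \<omega> = s} > 0")
    case True
    then have "cond_prob M (\<lambda>\<omega>. idx k \<omega> = j) (\<lambda>\<omega>. H \<omega> = s) = pmf (R (x s k)) j"
      using drawn k unfolding drawn_by_rule_def hist[OF s, symmetric] by blast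
    with True show ?thesis
      by (simp add: cond_prob_def field_simps conj_commute)
  next
    case False
    then have "prob {\<omega>\<in>space M. H \<omega> = s} = 0"
      using measure_nonneg[of M] by (simp add: not_less order_antisym)
    moreover have "prob {\<omega>\<in>space M. H \<omega> = s \<and> idx k \<omega> = j} \<le> prob {\<omega>\<in>space M. H \<omega> = s}"
      using s by (intro finite_measure_mono) auto
    ultimately show ?thesis
      using measure_nonneg[of M "{\<omega>\<in>space M. H \<omega> = s \<and> idx k \<omega> = j}"] by simp
  qed
  have Hidx: "(\<lambda>\<omega>. (H \<omega>, idx k \<omega>)) \<in> measurable M (count_space (T \<times> UNIV))"
  proof (subst measurable_count_space_eq2)
    show "finite (T \<times> (UNIV :: 'q set))"
      using T by simp
    have "(\<lambda>\<omega>. (H \<omega>, idx k \<omega>)) -` {(s, j)} \<inter> space M \<in> sets M" if s: "s \<in> T" for s j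
    proof -
      have "(\<lambda>\<omega>. (H \<omega>, idx k \<omega>)) -` {(s, j)} \<inter> space M
          = (H -` {s} \<inter> space M) \<inter> (idx k -` {j} \<inter> space M)"
        by auto
      also have "\<dots> \<in> sets M"
        using s by (intro sets.Int measurable_sets[OF H] measurable_sets[OF idx[OF k]]) auto
      finally show ?thesis .
    qed
    then show "(\<lambda>\<omega>. (H \<omega>, idx k \<omega>)) \<in> space M \<rightarrow> T \<times> UNIV \<and>
        (\<forall>a\<in>T \<times> UNIV. (\<lambda>\<omega>. (H \<omega>, idx k \<omega>)) -` {a} \<inter> space M \<in> sets M)"
      using measurable_space[OF H] by auto
  qed
  have restr: "F (\<lambda>l. idx l \<omega>) = F (H \<omega>)" "x (\<lambda>l. idx l \<omega>) k = x (H \<omega>) k" for \<omega>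
    by (auto simp: H_def intro!: F x)
  have "expectation (\<lambda>\<omega>. F (\<lambda>l. idx l \<omega>) (idx k \<omega>))
      = expectation (\<lambda>\<omega>. case_prod F (H \<omega>, idx k \<omega>))"
    by (simp add: restr)
  also have "\<dots> = (\<Sum>t\<in>T \<times> UNIV. case_prod F t * prob {\<omega>\<in>space M. (H \<omega>, idx k \<omega>) = t})"
    using T by (intro finite_range_integral(2)[OF _ Hidx]) simp
  also have "\<dots> = (\<Sum>s\<in>T. \<Sum>j\<in>UNIV. F s j * (prob {\<omega>\<in>space M. H \<omega> = s} * pmf (R (x s k)) j))"
    unfolding sum.cartesian_product by (intro sum.cong) (auto simp: law)
  also have "\<dots> = (\<Sum>s\<in>T. measure_pmf.expectation (R (x s k)) (F s) * prob {\<omega>\<in>space M. H \<omega> = s})"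
    by (intro sum.cong refl)
       (simp add: integral_measure_pmf[of UNIV] sum_distrib_right mult_ac)
  also have "\<dots> = expectation (\<lambda>\<omega>. measure_pmf.expectation (R (x (H \<omega>) k)) (F (H \<omega>)))"
    by (rule finite_range_integral(2)[OF T H, symmetric])
  finally show ?thesis
    by (simp add: restr)
qed

section \<open>Almost sure convergence from summable increments\<close>

text \<open>By monotone convergence the expected value of the series is the finite sum of the
  expectations, so the series is finite almost everywhere.\<close>

lemma AE_summable:
  fixes f :: "nat \<Rightarrow> 'a \<Rightarrow> real"
  assumes int: "\<And>k. integrable M (f k)" and nonneg: "\<And>k \<omega>. 0 \<le> f k \<omega>"
    and sum: "summable (\<lambda>k. expectation (f k))"
  shows "AE \<omega> in M. summable (\<lambda>k. f k \<omega>)"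
proof -
  have [measurable]: "f k \<in> borel_measurable M" for k
    using int by (rule borel_measurable_integrable)
  have "(\<integral>\<^sup>+\<omega>. (\<Sum>k. ennreal (f k \<omega>)) \<partial>M) = (\<Sum>k. \<integral>\<^sup>+\<omega>. ennreal (f k \<omega>) \<partial>M)"
    by (intro nn_integral_suminf) measurable
  also have "\<dots> = (\<Sum>k. ennreal (expectation (f k)))"
    using int nonneg by (simp add: nn_integral_eq_integral)
  also have "\<dots> \<noteq> \<infinity>"
    using sum nonneg by (simp add: ennreal_suminf_neq_top)
  finally have "AE \<omega> in M. (\<Sum>k. ennreal (f k \<omega>)) \<noteq> \<infinity>"
    by (intro nn_integral_PInf_AE) measurable
  then show ?thesis
    by eventually_elim (auto intro: summable_suminf_not_top nonneg)
qed

end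

lemma convergent_of_summable_increments:
  fixes x :: "nat \<Rightarrow> 'a::banach"
  assumes "summable (\<lambda>k. norm (x (Suc k) - x k))"
  shows "convergent x"
proof -
  have "convergent (\<lambda>n. \<Sum>k<n. x (Suc k) - x k)"
    using summable_norm_cancel[OF assms] by (simp add: summable_iff_convergent)
  then have "convergent (\<lambda>n. (x n - x 0) + x 0)"
    unfolding sum_lessThan_telescope by (intro convergent_add convergent_const)
  then show ?thesis
    by simp
qed

section \<open>The coupled linear recursion\<close>

text \<open>Summing the recursion avoids the closed form, which is unavailable for \<open>D = 0\<close>.\<close>

lemma summable_coupled_recursion:
  fixes P Q :: "nat \<Rightarrow> real"
  assumes nonneg: "\<And>k. 0 \<le> P k" "\<And>k. 0 \<le> Q k"
    and rec: "\<And>k. P (Suc k) \<le> a * P k + g * Q k" "\<And>k. Q (Suc k) \<le> c * P k + g * Q k"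
    and ac: "a < 1" "0 \<le> c" and gap: "g * c < (1 - g) * (1 - a)"
  shows "summable Q"
proof (rule summableI_nonneg_bounded)
  fix n
  define SP SQ where "SP = (\<Sum>k<n. P k)" and "SQ = (\<Sum>k<n. Q k)"
  \<comment> \<open>The right side exceeds the left by \<open>f n\<close>; this keeps the same range
    \<open>n\<close> on both sides when the recursion is summed.\<close>
  have shift: "(\<Sum>k<n. f k) \<le> f 0 + (\<Sum>k<n. f (Suc k))" if "\<And>k. 0 \<le> f k" for f :: "nat \<Rightarrow> real"
    using sum.lessThan_Suc_shift[of f n] that[of n] by simp
  have "(\<Sum>k<n. P (Suc k)) \<le> a * SP + g * SQ"
    unfolding SP_def SQ_def sum_distrib_left sum.distrib[symmetric] by (intro sum_mono rec)
  then have P: "SP * (1 - a) \<le> P 0 + g * SQ"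
    using shift[of P, OF nonneg(1)] by (simp add: SP_def algebra_simps)
  have "(\<Sum>k<n. Q (Suc k)) \<le> c * SP + g * SQ"
    unfolding SP_def SQ_def sum_distrib_left sum.distrib[symmetric] by (intro sum_mono rec)
  then have "SQ * (1 - g) \<le> Q 0 + c * SP"
    using shift[of Q, OF nonneg(2)] by (simp add: SQ_def algebra_simps)
  \<comment> \<open>Multiplying by \<open>1 - a\<close> allows the bound on
    \<open>SP * (1 - a)\<close> to be inserted. The coefficient of \<open>SQ\<close> becomes the
    gap, which is positive, and the bound no longer depends on \<open>n\<close>.\<close>
  then have "SQ * (1 - g) * (1 - a) \<le> (Q 0 + c * SP) * (1 - a)"
    using ac by (intro mult_right_mono) auto
  also have "\<dots> = Q 0 * (1 - a) + c * (SP * (1 - a))"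
    by (simp add: algebra_simps)
  also have "\<dots> \<le> Q 0 * (1 - a) + c * (P 0 + g * SQ)"
    using ac P by (intro add_left_mono mult_left_mono) auto
  finally have "SQ * ((1 - g) * (1 - a) - g * c) \<le> Q 0 * (1 - a) + c * P 0"
    by (simp add: algebra_simps)
  then show "(\<Sum>k<n. Q k) \<le> (Q 0 * (1 - a) + c * P 0) / ((1 - g) * (1 - a) - g * c)"
    using gap by (simp add: SQ_def pos_le_divide_eq)
qed (rule nonneg)

text \<open>The vectors \<open>(G1, 1)\<close> and \<open>(G2, 1)\<close> are eigenvectors of the
  matrix with rows \<open>(a, g)\<close> and \<open>(c, g)\<close>, for the eigenvalues
  \<open>r2\<close> and \<open>r1\<close>, and \<open>(1, 0)\<close> is \<open>G3\<close> times
  their difference. The bound is thus the matrix power applied to \<open>(d, 0)\<close>; nonnegative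
  entries let the inequalities propagate.\<close>

lemma coupled_recursion_bound:
  fixes P Q :: "nat \<Rightarrow> real"
  assumes rec: "\<And>k. P (Suc k) \<le> a * P k + g * Q k" "\<And>k. Q (Suc k) \<le> c * P k + g * Q k"
    and init: "P 0 \<le> d" "Q 0 \<le> 0"
    and nonneg: "0 \<le> a" "0 \<le> g" "0 < c" and "D \<noteq> 0" and D: "D\<^sup>2 = (a - g)\<^sup>2 + 4 * g * c"
    and G: "G1 = (a - g + D) / (2 * c)" "G2 = (a - g - D) / (2 * c)" "G3 = c / D"
    and r: "r1 = (a + g - D) / 2" "r2 = (a + g + D) / 2"
  shows "P k \<le> (- G2 * G3 * r1 ^ k + G1 * G3 * r2 ^ k) * d \<and> Q k \<le> (- G3 * r1 ^ k + G3 * r2 ^ k) * d"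
proof (induction k)
  case 0
  have "- G2 * G3 + G1 * G3 = 1"
    using nonneg(3) \<open>D \<noteq> 0\<close> by (simp add: G field_simps)
  with init show ?case
    by simp
next
  case (Suc k)
  let ?u = "\<lambda>k. - G2 * G3 * r1 ^ k + G1 * G3 * r2 ^ k"
  let ?v = "\<lambda>k. - G3 * r1 ^ k + G3 * r2 ^ k"
  have G3: "G3 * G1 = (a - g + D) / (2 * D)" "G3 * G2 = (a - g - D) / (2 * D)"
    using nonneg(3) by (simp_all add: G)
  have key: "(a - g - D) * (a + g - D) = 2 * (a * (a - g - D) + 2 * g * c)"
    "(a - g + D) * (a + g + D) = 2 * (a * (a - g + D) + 2 * g * c)"
    using D by (simp_all add: power2_eq_square algebra_simps)
  have frac: "y / (2 * c) * (z / 2) = a * (y / (2 * c)) + g"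
    if "y * z = 2 * (a * y + 2 * g * c)" for y z
    using that nonneg(3) by (simp add: field_simps)
  \<comment> \<open>First components of the eigenvector equations; \<open>root'\<close> gives the
    second ones.\<close>
  have root: "G2 * r1 = a * G2 + g" "G1 * r2 = a * G1 + g"
    unfolding G r by (rule frac[OF key(1)], rule frac[OF key(2)])
  have root': "r1 = c * G2 + g" "r2 = c * G1 + g"
    using nonneg(3) by (simp_all add: G r field_simps)
  have "- G2 * G3 * r1 ^ Suc k + G1 * G3 * r2 ^ Suc k
      = - G3 * (G2 * r1) * r1 ^ k + G3 * (G1 * r2) * r2 ^ k"
    by simp
  also have "\<dots> = a * ?u k + g * ?v k"
    unfolding root by (simp add: algebra_simps)
  finally have u: "?u (Suc k) = a * ?u k + g * ?v k" .
  have "?v (Suc k) = - G3 * r1 * r1 ^ k + G3 * r2 * r2 ^ k"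
    by simp
  also have "\<dots> = - G3 * (c * G2 + g) * r1 ^ k + G3 * (c * G1 + g) * r2 ^ k"
    by (simp only: root')
  also have "\<dots> = c * ?u k + g * ?v k"
    by (simp add: algebra_simps)
  finally have v: "?v (Suc k) = c * ?u k + g * ?v k" .
  have "P (Suc k) \<le> a * (?u k * d) + g * (?v k * d)"
    using Suc nonneg by (intro order_trans[OF rec(1)] add_mono mult_left_mono) auto
  moreover have "Q (Suc k) \<le> c * (?u k * d) + g * (?v k * d)"
    using Suc nonneg by (intro order_trans[OF rec(2)] add_mono mult_left_mono) auto
  ultimately show ?case
    unfolding u v by (simp add: algebra_simps)
qed

text \<open>Clearing the positive denominator shows that the characteristic polynomial of the
  recursion matrix is positive at 1.\<close>

lemma coupled_recursion_gap:
  fixes a g c :: real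
  assumes "a < 1" "0 < c" and "g < (1 - a) / (1 - a + c)"
  shows "g * c < (1 - g) * (1 - a)"
proof -
  have "0 < 1 - a + c"
    using assms by simp
  then show ?thesis
    using assms(3) by (simp add: pos_less_divide_eq algebra_simps)
qed

lemma coupled_recursion_constants:
  fixes a g c D G1 G2 G3 r1 r2 :: real
  assumes nonneg: "0 \<le> a" "a < 1" "0 \<le> g" "g < 1" "0 < c"
    and gap: "g * c < (1 - g) * (1 - a)"
    and D: "D = sqrt ((a - g)\<^sup>2 + 4 * g * c)"
    and G: "G1 = (a - g + D) / (2 * c)" "G2 = (a - g - D) / (2 * c)" "G3 = c / D"
    and r: "r1 = (a + g - D) / 2" "r2 = (a + g + D) / 2"
  shows "D\<^sup>2 = (a - g)\<^sup>2 + 4 * g * c" and "0 \<le> G3" and "\<bar>r1\<bar> \<le> r2" and "r2 < 1"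
    and "D \<noteq> 0 \<Longrightarrow> - G2 * G3 * r1 ^ k + G1 * G3 * r2 ^ k \<le> r2 ^ k"
    and "- G3 * r1 ^ k + G3 * r2 ^ k \<le> 2 * G3 * r2 ^ k"
proof -
  have D0: "0 \<le> D"
    using nonneg by (simp add: D)
  have "0 \<le> (a - g)\<^sup>2 + 4 * g * c"
    using nonneg by (intro add_nonneg_nonneg) auto
  then show sq: "D\<^sup>2 = (a - g)\<^sup>2 + 4 * g * c"
    by (simp add: D)
  \<comment> \<open>For \<open>D = 0\<close> division by zero gives \<open>G3 = 0\<close>, so this
    case is covered.\<close>
  show G3: "0 \<le> G3"
    using D0 nonneg by (simp add: G)
  show r12: "\<bar>r1\<bar> \<le> r2"
    using D0 nonneg by (simp add: r)
  \<comment> \<open>This is \<open>r2 < 1\<close> rewritten; replacing \<open>g * c\<close> by its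
    bound from the gap completes the square on the right.\<close>
  have "D < 2 - a - g"
  proof (rule power2_less_imp_less)
    have "D\<^sup>2 < (a - g)\<^sup>2 + 4 * ((1 - g) * (1 - a))"
      using gap sq by simp
    also have "\<dots> = (2 - a - g)\<^sup>2"
      by (simp add: power2_eq_square algebra_simps)
    finally show "D\<^sup>2 < (2 - a - g)\<^sup>2" .
  qed (use nonneg in simp)
  then show "r2 < 1"
    by (simp add: r)
  have pow: "\<bar>r1 ^ k\<bar> \<le> r2 ^ k"
    using power_mono[OF r12, of k] by (simp add: power_abs)
  have "G3 * (- (r1 ^ k)) \<le> G3 * r2 ^ k"
    using G3 pow by (intro mult_left_mono) auto
  then show "- G3 * r1 ^ k + G3 * r2 ^ k \<le> 2 * G3 * r2 ^ k"
    by simp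
  show "- G2 * G3 * r1 ^ k + G1 * G3 * r2 ^ k \<le> r2 ^ k" if "D \<noteq> 0"
  proof -
    \<comment> \<open>This makes the coefficient of \<open>r1 ^ k\<close> nonnegative, so
      \<open>r1 ^ k\<close> may be replaced by \<open>r2 ^ k\<close>; the two coefficients sum to
      1.\<close>
    have "\<bar>a - g\<bar> \<le> D"
      unfolding D using nonneg by (intro real_le_rsqrt) simp
    then have "G2 \<le> 0"
      using nonneg(5) by (simp add: G divide_nonpos_pos)
    then have "0 \<le> - G2 * G3"
      using G3 by (simp add: mult_nonpos_nonneg)
    then have "- G2 * G3 * r1 ^ k \<le> - G2 * G3 * r2 ^ k"
      using pow by (intro mult_left_mono) auto
    moreover have "- G2 * G3 = 1 - G1 * G3"
      using nonneg(5) that by (simp add: G field_simps)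
    then have "- G2 * G3 * r2 ^ k + G1 * G3 * r2 ^ k = r2 ^ k"
      by (simp only:) (simp add: algebra_simps)
    ultimately show ?thesis
      by linarith
  qed
qed

section \<open>The momentum iterates\<close>

text \<open>Strong induction, since the recursion reaches back two steps. Iterate \<open>k\<close>
  reads the indices \<open>1\<close> to \<open>k - 1\<close>, which makes it a function of the
  history; index 0 is never read.\<close>

lemma momentum_cong:
  assumes "\<And>l. l \<in> {1..<k} \<Longrightarrow> s l = t l"
  shows "momentum A b B S \<delta> \<gamma> x0 s k = momentum A b B S \<delta> \<gamma> x0 t k"
  using assms
proof (induction k rule: less_induct)
  case (less k)
  consider "k = 0" | "k = 1" | j where "k = Suc (Suc j)"
    by (metis One_nat_def old.nat.exhaust)
  then show ?case
  proof cases
    case 3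
    then show ?thesis
      using less.IH[of j] less.IH[of "Suc j"] less.prems by simp
  qed simp_all
qed

text \<open>The closed-form bounds carry the guard \<open>D \<noteq> 0\<close> because
  \<open>\<Gamma>3\<close> divides by \<open>D\<close>. Under the hypotheses \<open>D = 0\<close>
  happens only for \<open>\<gamma> = 0\<close> and \<open>h = 0\<close>; convergence and the claims
  on the constants include that case.\<close>

theorem theorem6p3:
  fixes A :: "real ^ 'n ^ 'm" and b :: "real ^ 'm" and B :: "real ^ 'n ^ 'n"
    and S :: "'q::finite \<Rightarrow> real ^ 'm" and R :: "real ^ 'n \<Rightarrow> 'q pmf"
    and X :: "(real ^ 'n) set"
    and \<mu>1 \<mu>2 \<delta> \<gamma> h \<Pi>1 \<Pi>2 \<Pi>3 \<Pi>4 D \<Gamma>1 \<Gamma>2 \<Gamma>3 \<rho>1 \<rho>2 :: real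
    and M :: "'w measure" and idx :: "nat \<Rightarrow> 'w \<Rightarrow> 'q"
    and x0 :: "real ^ 'n" and x :: "nat \<Rightarrow> 'w \<Rightarrow> real ^ 'n"
  assumes "\<And>i. row i A \<noteq> 0"
    and "X = feasible A b" and "X \<noteq> {}"
    and "sym_pos_def B"
    and "\<And>i. 0 \<le> S i" and "\<And>i. transpose A *v S i \<noteq> 0"
    and "\<mu>1 > 0" and "\<mu>2 \<le> 1"
    and "\<And>y. \<mu>1 / 2 * (B_dist B y X)\<^sup>2 \<le> expected_loss A b B S R y"
    and "\<And>y. expected_loss A b B S R y \<le> \<mu>2 / 2 * (B_dist B y X)\<^sup>2"
    and "h = 1 - (2 * \<delta> - \<delta>\<^sup>2) * \<mu>1"
    and "0 < \<delta>" and "\<delta> < 2" and "0 \<le> \<gamma>" and "\<gamma> < 1"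
    and "\<gamma> < (1 - sqrt h) / (1 - sqrt h + \<delta> * sqrt \<mu>2)"
    and "prob_space M"
    and "drawn_by_rule M R (momentum A b B S \<delta> \<gamma> x0) idx"
    and "x = (\<lambda>k \<omega>. momentum A b B S \<delta> \<gamma> x0 (\<lambda>l. idx l \<omega>) k)"
    and "\<Pi>1 = sqrt h" and "\<Pi>2 = \<gamma>" and "\<Pi>4 = \<gamma>" and "\<Pi>3 = \<delta> * sqrt \<mu>2"
    and "D = sqrt ((\<Pi>1 - \<Pi>4)\<^sup>2 + 4 * \<Pi>2 * \<Pi>3)"
    and "\<Gamma>1 = (\<Pi>1 - \<Pi>4 + D) / (2 * \<Pi>3)"
    and "\<Gamma>2 = (\<Pi>1 - \<Pi>4 - D) / (2 * \<Pi>3)"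
    and "\<Gamma>3 = \<Pi>3 / D"
    and "\<rho>1 = (\<Pi>1 + \<Pi>4 - D) / 2"
    and "\<rho>2 = (\<Pi>1 + \<Pi>4 + D) / 2"
  shows "(AE \<omega> in M. convergent (\<lambda>k. x k \<omega>))
    \<and> (D \<noteq> 0 \<longrightarrow> (\<forall>k\<ge>1.
          prob_space.expectation M (\<lambda>\<omega>. B_dist B (x (k + 1) \<omega>) X)
            \<le> (- \<Gamma>2 * \<Gamma>3 * \<rho>1 ^ k + \<Gamma>1 * \<Gamma>3 * \<rho>2 ^ k) * B_dist B x0 X
        \<and> prob_space.expectation M (\<lambda>\<omega>. B_norm B (x (k + 1) \<omega> - x k \<omega>))
            \<le> (- \<Gamma>3 * \<rho>1 ^ k + \<Gamma>3 * \<rho>2 ^ k) * B_dist B x0 X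
        \<and> (- \<Gamma>2 * \<Gamma>3 * \<rho>1 ^ k + \<Gamma>1 * \<Gamma>3 * \<rho>2 ^ k) * B_dist B x0 X
            \<le> \<rho>2 ^ k * B_dist B x0 X
        \<and> (- \<Gamma>3 * \<rho>1 ^ k + \<Gamma>3 * \<rho>2 ^ k) * B_dist B x0 X
            \<le> 2 * \<Gamma>3 * \<rho>2 ^ k * B_dist B x0 X))
    \<and> \<Gamma>3 \<ge> 0 \<and> 0 \<le> \<bar>\<rho>1\<bar> \<and> \<bar>\<rho>1\<bar> \<le> \<rho>2 \<and> \<rho>2 < 1"
proof -
  interpret spd_form B
    by unfold_locales fact
  interpret prob_space M
    by fact
  note X = \<open>X = feasible A b\<close>
  note ne = \<open>X \<noteq> {}\<close>
  note x_def = \<open>x = (\<lambda>k \<omega>. momentum A b B S \<delta> \<gamma> x0 (\<lambda>l. idx l \<omega>) k)\<close>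
  note drawn = \<open>drawn_by_rule M R (momentum A b B S \<delta> \<gamma> x0) idx\<close>
  let ?m = "momentum A b B S \<delta> \<gamma> x0"
  let ?g = "\<lambda>y i. sketch_grad A b B (S i) y"

  have "\<mu>1 \<le> \<mu>2"
    using assms(1) ne assms(9,10) unfolding X by (rule spectral_constants_le)
  with assms have \<mu>: "0 < \<mu>1" "\<mu>1 \<le> 1" "0 < \<mu>2"
    by auto
  \<comment> \<open>The first form shows that the factor is at most 1, the second that it is
    positive; with \<open>\<mu>1 \<le> 1\<close> this places \<open>h\<close> in the interval from 0
    to 1, excluding 1.\<close>
  have "(2 * \<delta> - \<delta>\<^sup>2) = 1 - (1 - \<delta>)\<^sup>2" "(2 * \<delta> - \<delta>\<^sup>2) = \<delta> * (2 - \<delta>)"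
    by (simp_all add: power2_eq_square algebra_simps)
  then have "2 * \<delta> - \<delta>\<^sup>2 \<le> 1" "0 < 2 * \<delta> - \<delta>\<^sup>2"
    using zero_le_power2[of "1 - \<delta>"] mult_pos_pos[of \<delta> "2 - \<delta>"] assms(12,13) by linarith+
  then have "(2 * \<delta> - \<delta>\<^sup>2) * \<mu>1 \<le> 1" "0 < (2 * \<delta> - \<delta>\<^sup>2) * \<mu>1"
    using \<mu> by (simp_all add: mult_le_one)
  then have "0 \<le> h" "h < 1"
    by (simp_all add: \<open>h = _\<close>)
  then have a: "0 \<le> sqrt h" "sqrt h < 1"
    by simp_all
  have c: "0 < \<delta> * sqrt \<mu>2"
    using \<mu> assms(12) by simp
  note \<gamma> = \<open>0 \<le> \<gamma>\<close> \<open>\<gamma> < 1\<close>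
  note gap = coupled_recursion_gap[OF a(2) c assms(16)]
  note \<Pi> = \<open>\<Pi>1 = sqrt h\<close> \<open>\<Pi>2 = \<gamma>\<close> \<open>\<Pi>3 = \<delta> * sqrt \<mu>2\<close> \<open>\<Pi>4 = \<gamma>\<close>
  note constants = coupled_recursion_constants[OF a \<gamma> c gap, of D \<Gamma>1 \<Gamma>2 \<Gamma>3 \<rho>1 \<rho>2,
      OF assms(24-29)[unfolded \<Pi>]]

  have idx: "idx l \<in> measurable M (count_space UNIV)" if "1 \<le> l" for l
    using drawn that by (simp add: drawn_by_rule_def)
  have integrable: "integrable M (\<lambda>\<omega>. G (x k \<omega>) (x (Suc k) \<omega>) (idx (Suc k) \<omega>))"
    for G :: "real ^ 'n \<Rightarrow> real ^ 'n \<Rightarrow> 'q \<Rightarrow> real" and k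
    unfolding x_def
  proof (rule integrable_history[of "{1..<Suc (Suc k)}" idx
        "\<lambda>s. G (?m s k) (?m s (Suc k)) (s (Suc k))"])
    fix s t :: "nat \<Rightarrow> 'q" assume st: "\<And>l. l \<in> {1..<Suc (Suc k)} \<Longrightarrow> s l = t l"
    have "?m s k = ?m t k" "?m s (Suc k) = ?m t (Suc k)"
      by (rule momentum_cong, rule st, simp)+
    moreover have "s (Suc k) = t (Suc k)"
      by (rule st) simp
    ultimately show "G (?m s k) (?m s (Suc k)) (s (Suc k)) = G (?m t k) (?m t (Suc k)) (t (Suc k))"
      by simp
  qed (simp_all add: idx)
  \<comment> \<open>The shift makes \<open>k\<close> match the exponent in the theorem:
    \<open>P 0\<close> is the distance of the first iterate, which equals \<open>x0\<close>, and
    \<open>Q 0 = 0\<close>.\<close>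
  define P where "P k = expectation (\<lambda>\<omega>. B_dist B (x (Suc k) \<omega>) X)" for k
  define Q where "Q k = expectation (\<lambda>\<omega>. B_norm B (x (Suc k) \<omega> - x k \<omega>))" for k
  have intP: "integrable M (\<lambda>\<omega>. B_dist B (x k \<omega>) X)" for k
    by (rule integrable[of "\<lambda>y _ _. B_dist B y X"])
  have intQ: "integrable M (\<lambda>\<omega>. B_norm B (x (Suc k) \<omega> - x k \<omega>))" for k
    by (rule integrable[of "\<lambda>y z _. B_norm B (z - y)"])
  have x_Suc: "x (Suc (Suc k)) \<omega> = x (Suc k) \<omega> - \<delta> *\<^sub>R ?g (x (Suc k) \<omega>) (idx (Suc k) \<omega>)
      + \<gamma> *\<^sub>R (x (Suc k) \<omega> - x k \<omega>)" for k \<omega>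
    by (simp add: x_def)
  \<comment> \<open>A mean bound valid at every point is carried to the random iterate by
    conditioning on the history.\<close>
  have step: "expectation (\<lambda>\<omega>. G (x (Suc k) \<omega>) (idx (Suc k) \<omega>)) \<le> C * P k"
    if G: "\<And>y. measure_pmf.expectation (R y) (G y) \<le> C * B_dist B y X"
    for G :: "real ^ 'n \<Rightarrow> 'q \<Rightarrow> real" and C k
  proof -
    have "expectation (\<lambda>\<omega>. G (x (Suc k) \<omega>) (idx (Suc k) \<omega>))
        = expectation (\<lambda>\<omega>. measure_pmf.expectation (R (x (Suc k) \<omega>)) (G (x (Suc k) \<omega>)))"
      unfolding x_def
    proof (rule expectation_drawn_by_rule[OF drawn, of "Suc k" "\<lambda>s. G (?m s (Suc k))"])
      fix s t :: "nat \<Rightarrow> 'q" and j assume st: "\<And>l. l \<in> {1..<Suc k} \<Longrightarrow> s l = t l"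
      show "?m s (Suc k) = ?m t (Suc k)"
        by (rule momentum_cong) (rule st)
      then show "G (?m s (Suc k)) j = G (?m t (Suc k)) j"
        by simp
    qed simp
    also have "\<dots> \<le> expectation (\<lambda>\<omega>. C * B_dist B (x (Suc k) \<omega>) X)"
      by (intro integral_mono G integrable_mult_right intP
          integrable[of "\<lambda>_ z _. measure_pmf.expectation (R z) (G z)"])
    finally show ?thesis
      by (simp add: P_def)
  qed
  have recP: "P (Suc k) \<le> sqrt h * P k + \<gamma> * Q k" for k
  proof -
    let ?d = "\<lambda>\<omega>. B_dist B (x (Suc k) \<omega> - \<delta> *\<^sub>R ?g (x (Suc k) \<omega>) (idx (Suc k) \<omega>)) X"
    let ?e = "\<lambda>\<omega>. B_norm B (x (Suc k) \<omega> - x k \<omega>)"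
    have int: "integrable M ?d"
      by (rule integrable[of "\<lambda>_ z i. B_dist B (z - \<delta> *\<^sub>R ?g z i) X"])
    have "P (Suc k) \<le> expectation (\<lambda>\<omega>. ?d \<omega> + \<gamma> * ?e \<omega>)"
      unfolding P_def
    proof (intro integral_mono intP Bochner_Integration.integrable_add int
        integrable_mult_right intQ)
      show "B_dist B (x (Suc (Suc k)) \<omega>) X \<le> ?d \<omega> + \<gamma> * ?e \<omega>" for \<omega>
        unfolding x_Suc by (rule order_trans[OF B_dist_add_le[OF ne]])
          (use \<gamma> in \<open>simp add: B_norm_scaleR\<close>)
    qed
    also have "\<dots> = expectation ?d + \<gamma> * Q k"
      by (subst Bochner_Integration.integral_add) (auto simp: Q_def int intQ)
    also have "expectation ?d \<le> sqrt h * P k"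
      unfolding X assms(11)
      by (rule step, unfold X, rule expectation_B_dist_sketch_step)
         (use assms(5,6,9,12,13) ne in \<open>auto simp: X expected_loss_def simp del: transpose_matrix_vector\<close>)
    finally show ?thesis
      by simp
  qed
  have recQ: "Q (Suc k) \<le> (\<delta> * sqrt \<mu>2) * P k + \<gamma> * Q k" for k
  proof -
    let ?n = "\<lambda>\<omega>. B_norm B (?g (x (Suc k) \<omega>) (idx (Suc k) \<omega>))"
    let ?e = "\<lambda>\<omega>. B_norm B (x (Suc k) \<omega> - x k \<omega>)"
    have int: "integrable M ?n"
      by (rule integrable[of "\<lambda>_ z i. B_norm B (?g z i)"])
    have "Q (Suc k) \<le> expectation (\<lambda>\<omega>. \<delta> * ?n \<omega> + \<gamma> * ?e \<omega>)"
      unfolding Q_def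
    proof (intro integral_mono intQ Bochner_Integration.integrable_add int integrable_mult_right)
      fix \<omega>
      have "x (Suc (Suc k)) \<omega> - x (Suc k) \<omega>
          = (- \<delta>) *\<^sub>R ?g (x (Suc k) \<omega>) (idx (Suc k) \<omega>) + \<gamma> *\<^sub>R (x (Suc k) \<omega> - x k \<omega>)"
        by (simp add: x_Suc)
      then show "B_norm B (x (Suc (Suc k)) \<omega> - x (Suc k) \<omega>) \<le> \<delta> * ?n \<omega> + \<gamma> * ?e \<omega>"
        using \<gamma> assms(12) by (metis B_norm_triangle B_norm_scaleR abs_minus_cancel
            abs_of_nonneg less_imp_le)
    qed
    also have "\<dots> = \<delta> * expectation ?n + \<gamma> * Q k"
      by (subst Bochner_Integration.integral_add) (auto simp: Q_def int intQ)
    also have "expectation ?n \<le> sqrt \<mu>2 * P k"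
      by (rule step, unfold X, rule expectation_B_norm_sketch_grad)
         (use assms(6,10) ne in \<open>auto simp: X expected_loss_def simp del: transpose_matrix_vector\<close>)
    finally show ?thesis
      using assms(12) by (simp add: mult.assoc)
  qed
  have nonneg: "0 \<le> P k" "0 \<le> Q k" for k
    by (auto simp: P_def Q_def intro!: Bochner_Integration.integral_nonneg B_dist_nonneg ne
        B_norm_nonneg)
  have init: "P 0 = B_dist B x0 X" "Q 0 = 0"
    by (simp_all add: P_def Q_def x_def B_norm_zero prob_space)

  have "AE \<omega> in M. convergent (\<lambda>k. x k \<omega>)"
  proof -
    have "summable Q"
      by (rule summable_coupled_recursion[where P = P and Q = Q, OF nonneg recP recQ a(2) less_imp_le[OF c] gap])
    then have sum: "AE \<omega> in M. summable (\<lambda>k. B_norm B (x (Suc k) \<omega> - x k \<omega>))"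
      unfolding Q_def by (intro AE_summable intQ B_norm_nonneg)
    \<comment> \<open>Summability passes from the \<open>B\<close>-norm to the Euclidean norm, in
      which convergence is stated.\<close>
    obtain C where C: "\<And>v. norm v \<le> C * B_norm B v"
      using norm_le_B_norm by blast
    from sum show ?thesis
    proof eventually_elim
      case (elim \<omega>)
      then have "summable (\<lambda>k. C * B_norm B (x (Suc k) \<omega> - x k \<omega>))"
        by (rule summable_mult)
      then have "summable (\<lambda>k. norm (x (Suc k) \<omega> - x k \<omega>))"
        by (rule summable_comparison_test'[where N = 0]) (simp add: C)
      then show ?case
        by (rule convergent_of_summable_increments)
    qed
  qed
  moreover have "P k \<le> (- \<Gamma>2 * \<Gamma>3 * \<rho>1 ^ k + \<Gamma>1 * \<Gamma>3 * \<rho>2 ^ k) * B_dist B x0 X \<and>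
      Q k \<le> (- \<Gamma>3 * \<rho>1 ^ k + \<Gamma>3 * \<rho>2 ^ k) * B_dist B x0 X" if "D \<noteq> 0" for k
    by (rule coupled_recursion_bound[where P = P and Q = Q, OF recP recQ _ _ a(1) \<gamma>(1) c that constants(1)])
       (use init assms(25-29)[unfolded \<Pi>] in auto)
  ultimately show ?thesis
    using constants(2-4) mult_right_mono[OF constants(5) B_dist_nonneg[OF ne]]
      mult_right_mono[OF constants(6) B_dist_nonneg[OF ne]]
    unfolding P_def Q_def by (simp add: mult.assoc)
qed

end
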